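(* Let $F$ be a simple graph of order $n\ge 2$, let $E_k=\{e_1,\ldots,e_k\}$ be a subset of the edge set of $F$, and let $H_{uv}$ be a simple graph of order $m\ge 3$ with a specified edge $uv$ such that $H_{uv}-u$ is isomorphic to $H_{uv}-v$ and such that $u$ and $v$ both have degree $m-1$ in $H_{uv}$. Let $H_2=H_{uv}-\{u,v\}$ be an $r_2$-regular graph, where $r_2\ge 2$. Let $q\in\sigma(Q(H_{uv}))\setminus\{m-2,\zeta,\eta\}$, where $\zeta,\eta$ are the roots of the equation $(x-2r_2-2)(x-m)-2(m-2)=0$, and let $G=G[F,E_k,H_{uv}]$. Assume that $\mathscr{E}_k$, the subgraph of $F$ induced by $E_k$, is $r$-regular. If $|E_k|=k$, then $q\in\sigma(Q(G))$ with multiplicity $k$. Moreover, the remaining $n+k$ $Q$-eigenvalues of $G$ are independent of $H_{uv}$.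
   Context: All graphs are finite and simple. For a graph $X$, $Q(X)=D(X)+A(X)$ is the signless Laplacian matrix, where $D(X)$ is the diagonal degree matrix and $A(X)$ the adjacency matrix; the $Q$-eigenvalues of $X$ are the eigenvalues of $Q(X)$, and $\sigma(Q(X))$ is the spectrum of $Q(X)$, consisting of all its eigenvalues. For a graph $X$ of order $s$, $q_1(X)\le\cdots\le q_s(X)$ denote the eigenvalues of $Q(X)$. Under the stated hypotheses, $\sigma(Q(H_{uv}))=\{q_j(H_2)+2 : 1\le j\le m-3\}\cup\{m-2,\zeta,\eta\}$. The subgraph induced by $E_k$ has edge set $E_k$ and, as vertices, the endpoints of the edges in $E_k$. Graph with $k$ edge-pockets: $G[F,E_k,H_{uv}]$ is the graph obtained by taking one copy of $F$ and $k$ vertex-disjoint copies of $H_{uv}$, and then, for each $i=1,\ldots,k$, pasting (identifying) the edge $uv$ in the $i$th copy of $H_{uv}$ with the edge $e_i\in E_k$.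
   Formalization: "Multiplicity k" is read as: each q listed in the spectrum of H_uv (one copy of m-2, ζ, η removed) contributes k copies, so at least k (exactly k fails for F=K_2, H_2=C_5); "independent of H_uv" means: the same for all H_uv with the same m and r_2, since both affect the sum of the rest. *)

theory Defs
  imports Jordan_Normal_Form.Char_Poly
begin

record 'a sgraph =
  verts :: "'a set"
  edges :: "'a set set"

definition simple_graph :: "'a sgraph \<Rightarrow> bool" where
  "simple_graph X \<longleftrightarrow> finite (verts X) \<and> (\<forall>e\<in>edges X. e \<subseteq> verts X \<and> card e = 2)"

definition vertex_degree :: "'a sgraph \<Rightarrow> 'a \<Rightarrow> nat" where
  "vertex_degree X x = card {e \<in> edges X. x \<in> e}"

definition regular :: "'a sgraph \<Rightarrow> nat \<Rightarrow> bool" where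
  "regular X r \<longleftrightarrow> (\<forall>x\<in>verts X. vertex_degree X x = r)"

definition delete_verts :: "'a sgraph \<Rightarrow> 'a set \<Rightarrow> 'a sgraph" where
  "delete_verts X S = \<lparr>verts = verts X - S, edges = {e \<in> edges X. e \<inter> S = {}}\<rparr>"

definition isomorphic :: "'a sgraph \<Rightarrow> 'b sgraph \<Rightarrow> bool" where
  "isomorphic X Y \<longleftrightarrow>
     (\<exists>f. bij_betw f (verts X) (verts Y) \<and> edges Y = (\<lambda>e. f ` e) ` edges X)"

definition edge_induced_subgraph :: "'a set set \<Rightarrow> 'a sgraph" where
  "edge_induced_subgraph E = \<lparr>verts = \<Union>E, edges = E\<rparr>"


text \<open>
  Matrices are indexed by \<open>{0..<n}\<close>, so a matrix of a graph refers to an enumeration of its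
  vertices.  Another enumeration conjugates the matrix by a permutation matrix, which does not
  affect the spectrum.
\<close>

definition vertex_list :: "'a sgraph \<Rightarrow> 'a list" where
  "vertex_list X = (SOME vs. distinct vs \<and> set vs = verts X)"

definition degree_matrix :: "'a sgraph \<Rightarrow> real mat" where
  "degree_matrix X = (let vs = vertex_list X in
     mat (length vs) (length vs) (\<lambda>(i, j). if i = j then real (vertex_degree X (vs ! i)) else 0))"

definition adjacency_matrix :: "'a sgraph \<Rightarrow> real mat" where
  "adjacency_matrix X = (let vs = vertex_list X in
     mat (length vs) (length vs) (\<lambda>(i, j). if {vs ! i, vs ! j} \<in> edges X then 1 else 0))"

definition signless_laplacian :: "'a sgraph \<Rightarrow> real mat" where
  "signless_laplacian X = degree_matrix X + adjacency_matrix X"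

text \<open>
  The spectrum is a multiset: eigenvalues are listed with multiplicity.  As the signless
  Laplacian is real and symmetric, its real eigenvalues are all its eigenvalues, and algebraic
  and geometric multiplicities agree.
\<close>

definition Q_spectrum :: "'a sgraph \<Rightarrow> real multiset" where
  "Q_spectrum X = proots (char_poly (signless_laplacian X))"


text \<open>
  Pasting the edge \<open>uv\<close> onto an edge \<open>e\<close> requires saying which endpoint of \<open>e\<close> is identified with
  \<open>u\<close> (the first component of \<open>p e\<close>) and which with \<open>v\<close> (the second component).
\<close>

definition orientation :: "'a set set \<Rightarrow> ('a set \<Rightarrow> 'a \<times> 'a) \<Rightarrow> bool" where
  "orientation E p \<longleftrightarrow> (\<forall>e\<in>E. e = {fst (p e), snd (p e)})"

text \<open>
  The quotient map from the copy of \<open>H\<close> belonging to the edge \<open>e\<close>: a vertex \<open>x\<close> other than \<open>u, v\<close>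
  becomes the new vertex \<open>Inr (e, x)\<close>, while \<open>u, v\<close> become vertices of the base graph.
\<close>

definition paste :: "('a set \<Rightarrow> 'a \<times> 'a) \<Rightarrow> 'b \<Rightarrow> 'b \<Rightarrow> 'a set \<Rightarrow> 'b \<Rightarrow> 'a + 'a set \<times> 'b" where
  "paste p u v e x =
     (if x = u then Inl (fst (p e)) else if x = v then Inl (snd (p e)) else Inr (e, x))"

definition pocket_graph ::
  "'a sgraph \<Rightarrow> 'a set set \<Rightarrow> ('a set \<Rightarrow> 'a \<times> 'a) \<Rightarrow> 'b sgraph \<Rightarrow> 'b \<Rightarrow> 'b \<Rightarrow>
     ('a + 'a set \<times> 'b) sgraph" where
  "pocket_graph F E p H u v =
     \<lparr>verts = Inl ` verts F \<union> (\<Union>e\<in>E. paste p u v e ` verts H),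
      edges = (\<lambda>f. Inl ` f) ` edges F \<union> (\<Union>e\<in>E. (\<lambda>f. paste p u v e ` f) ` edges H)\<rparr>"

definition edge_pocket :: "'b sgraph \<Rightarrow> 'b \<Rightarrow> 'b \<Rightarrow> nat \<Rightarrow> nat \<Rightarrow> bool" where
  "edge_pocket H u v m r\<^sub>2 \<longleftrightarrow>
     simple_graph H \<and> card (verts H) = m \<and> {u, v} \<in> edges H \<and>
     isomorphic (delete_verts H {u}) (delete_verts H {v}) \<and>
     vertex_degree H u = m - 1 \<and> vertex_degree H v = m - 1 \<and>
     regular (delete_verts H {u, v}) r\<^sub>2"

end

theory Submission
  imports Defs
begin

text \<open>
  Put \<open>c = 2 r\<^sub>2 + 2\<close> and \<open>h = m - 2\<close>, and let \<open>P\<close> (\<open>interior_poly\<close>) be the characteristic polynomial of the diagonal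
  block of \<open>Q(H)\<close> on the interior vertices \<open>H - {u, v}\<close>.  All rows of that block sum to \<open>c\<close>, so
  \<open>P = (x - c) g\<close> for some \<open>g\<close> (\<open>reduced_poly\<close>).  The vertices \<open>u\<close> and \<open>v\<close> are adjacent to every interior vertex, so the
  off-diagonal blocks are constant along the interior of a copy.  Hence eliminating the interiors by
  a Schur complement needs no inverse of the block: on constant vectors it acts as multiplication
  by \<open>1 / (x - c)\<close>.  For \<open>H\<close> itself this gives
  \<open>g (x - h) ((x - c) (x - m) - 2 h)\<close>, and for the pocket graph it gives \<open>P^k\<close> times a determinant
  over the vertices of \<open>F\<close>.  The same elimination applied to a quotient matrix of order \<open>n + k\<close>, in
  which every interior is collapsed to one index, produces that determinant times \<open>(x - c)^k\<close>.
  So the characteristic polynomial of the pocket graph is \<open>g^k\<close> times that of the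
  quotient matrix, which depends on \<open>H\<close> only through \<open>m\<close> and \<open>r\<^sub>2\<close>.
\<close>

subsection \<open>Determinants indexed by finite sets\<close>

definition lmat :: "('a \<Rightarrow> 'b \<Rightarrow> 'c) \<Rightarrow> 'a list \<Rightarrow> 'b list \<Rightarrow> 'c mat" where
  "lmat M vs ws = mat (length vs) (length ws) (\<lambda>(i, j). M (vs ! i) (ws ! j))"

lemma lmat_carrier [simp]: "lmat M vs ws \<in> carrier_mat (length vs) (length ws)"
  by (simp add: lmat_def)

lemma lmat_cong:
  assumes "\<And>a b. a \<in> set vs \<Longrightarrow> b \<in> set ws \<Longrightarrow> M a b = N a b"
  shows "lmat M vs ws = lmat N vs ws"
  using assms by (auto simp: lmat_def intro!: eq_matI)

lemma lmat_mult:
  fixes M :: "'a \<Rightarrow> 'b \<Rightarrow> 'd :: comm_ring_1"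
  assumes "distinct vs"
  shows "lmat M us vs * lmat N vs ws = lmat (\<lambda>a c. \<Sum>b\<in>set vs. M a b * N b c) us ws"
proof -
  have "(\<Sum>b\<in>set vs. f b) = (\<Sum>i<length vs. f (vs ! i))" for f :: "'b \<Rightarrow> 'd"
    by (rule sum.reindex_bij_betw [symmetric])
      (use assms bij_betw_nth in blast)
  then show ?thesis
    by (auto simp: lmat_def scalar_prod_def atLeast0LessThan intro!: eq_matI)
qed

lemma lmat_delta: "distinct vs \<Longrightarrow> lmat (\<lambda>a b. if a = b then 1 else 0) vs vs = 1\<^sub>m (length vs)"
  by (auto simp: lmat_def nth_eq_iff_index_eq intro!: eq_matI)

lemma lmat_append:
  "lmat M (vs @ ws) (vs @ ws) =
     four_block_mat (lmat M vs vs) (lmat M vs ws) (lmat M ws vs) (lmat M ws ws)"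
  by (auto simp: lmat_def nth_append intro!: eq_matI)

text \<open>Reordering conjugates by the permutation matrix \<open>lmat ?\<delta> vs ws\<close>; its
  determinant and that of its transpose multiply to 1, so the determinant is unchanged.\<close>

lemma det_lmat_permute:
  fixes M :: "'a \<Rightarrow> 'a \<Rightarrow> 'c :: comm_ring_1"
  assumes "distinct vs" "distinct ws" "set vs = set ws"
  shows "det (lmat M vs vs) = det (lmat M ws ws)"
proof -
  let ?\<delta> = "\<lambda>a b :: 'a. if a = b then 1 else 0 :: 'c"
  have delta: "?\<delta> a b * x = (if a = b then x else 0)" "x * ?\<delta> a b = (if a = b then x else 0)" for a b x
    by auto
  have len: "length vs = length ws"
    using assms by (metis distinct_card)
  have c: "lmat L xs ys \<in> carrier_mat (length ws) (length ws)"
    if "xs \<in> {vs, ws}" "ys \<in> {vs, ws}" for L :: "'a \<Rightarrow> 'a \<Rightarrow> 'c" and xs ys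
    using that len by (auto simp: lmat_def)
  have "lmat ?\<delta> vs ws * lmat M ws ws * lmat ?\<delta> ws vs = lmat M vs vs"
    unfolding lmat_mult [OF assms(2)]
    by (rule lmat_cong) (use assms(3) in \<open>auto simp: delta\<close>)
  moreover have "lmat ?\<delta> vs ws * lmat ?\<delta> ws vs = lmat ?\<delta> vs vs"
    unfolding lmat_mult [OF assms(2)]
    by (rule lmat_cong) (use assms(3) in \<open>auto simp: delta\<close>)
  then have "det (lmat ?\<delta> vs ws) * det (lmat ?\<delta> ws vs) = 1"
    using det_mult [OF c c, of vs ws ws vs ?\<delta> ?\<delta>] by (simp add: lmat_delta assms)
  ultimately show ?thesis
    using det_mult [OF c c, of vs ws ws ws ?\<delta> M]
      det_mult [OF mult_carrier_mat [OF c c] c, of vs ws ws ws ws vs ?\<delta> M ?\<delta>]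
    by (simp add: algebra_simps)
qed

text \<open>Indexing by a set lets vertices of sum and product types serve as indices; by
  \<open>det_lmat_permute\<close> the chosen enumeration is immaterial.\<close>

definition set_det :: "'a set \<Rightarrow> ('a \<Rightarrow> 'a \<Rightarrow> 'c :: comm_ring_1) \<Rightarrow> 'c" where
  "set_det A M = (let vs = (SOME vs. distinct vs \<and> set vs = A) in det (lmat M vs vs))"

lemma set_det_eq:
  assumes "distinct vs" "set vs = A"
  shows "set_det A M = det (lmat M vs vs)"
proof -
  have "distinct (SOME vs. distinct vs \<and> set vs = A) \<and> set (SOME vs. distinct vs \<and> set vs = A) = A"
    by (rule someI_ex) (use assms in blast)
  then show ?thesis
    unfolding set_det_def Let_def using assms by (intro det_lmat_permute) auto
qed

lemma set_det_cong:
  assumes "finite A" "\<And>a b. a \<in> A \<Longrightarrow> b \<in> A \<Longrightarrow> M a b = N a b"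
  shows "set_det A M = set_det A N"
  using finite_distinct_list [OF assms(1)] assms(2)
  by (auto simp: set_det_eq intro!: arg_cong [where f = det] lmat_cong)

lemma set_det_empty [simp]: "set_det {} M = 1"
  by (simp add: set_det_eq [of "[]"] lmat_def)

lemma set_det_image:
  assumes "finite A" "inj_on f A"
  shows "set_det (f ` A) M = set_det A (\<lambda>a b. M (f a) (f b))"
proof -
  obtain vs where vs: "distinct vs" "set vs = A"
    using finite_distinct_list [OF assms(1)] by blast
  then show ?thesis
    using assms(2)
    by (auto simp: set_det_eq [of vs] set_det_eq [of "map f vs"] distinct_map lmat_def
        intro!: arg_cong [where f = det] eq_matI)
qed

lemma set_det_Un_lower_zero:
  fixes M :: "'a \<Rightarrow> 'a \<Rightarrow> 'c :: idom"
  assumes "finite A" "finite B" "A \<inter> B = {}" "\<And>a b. a \<in> A \<Longrightarrow> b \<in> B \<Longrightarrow> M b a = 0"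
  shows "set_det (A \<union> B) M = set_det A M * set_det B M"
proof -
  obtain vs ws where vs: "distinct vs" "set vs = A" and ws: "distinct ws" "set ws = B"
    using finite_distinct_list assms(1,2) by meson
  have "lmat M ws vs = 0\<^sub>m (length ws) (length vs)"
    using assms(4) vs ws by (auto simp: lmat_def intro!: eq_matI)
  then have "det (lmat M (vs @ ws) (vs @ ws)) = det (lmat M vs vs) * det (lmat M ws ws)"
    unfolding lmat_append by (intro det_four_block_mat_lower_left_zero) auto
  then show ?thesis
    using vs ws assms(3) by (simp add: set_det_eq [of vs] set_det_eq [of ws] set_det_eq [of "vs @ ws"])
qed

lemma set_det_Un_upper_zero:
  fixes M :: "'a \<Rightarrow> 'a \<Rightarrow> 'c :: idom"
  assumes "finite A" "finite B" "A \<inter> B = {}" "\<And>a b. a \<in> A \<Longrightarrow> b \<in> B \<Longrightarrow> M a b = 0"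
  shows "set_det (A \<union> B) M = set_det A M * set_det B M"
  using set_det_Un_lower_zero [of B A M] assms by (simp add: Un_commute Int_commute mult.commute)

lemma set_det_UN_diagonal:
  fixes M :: "'a \<Rightarrow> 'a \<Rightarrow> 'c :: idom"
  assumes "finite I" "\<And>i. i \<in> I \<Longrightarrow> finite (A i)"
    "\<And>i j. i \<in> I \<Longrightarrow> j \<in> I \<Longrightarrow> i \<noteq> j \<Longrightarrow> A i \<inter> A j = {}"
    "\<And>i j a b. i \<in> I \<Longrightarrow> j \<in> I \<Longrightarrow> i \<noteq> j \<Longrightarrow> a \<in> A i \<Longrightarrow> b \<in> A j \<Longrightarrow> M a b = 0"
  shows "set_det (\<Union>i\<in>I. A i) M = (\<Prod>i\<in>I. set_det (A i) M)"
  using assms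
proof (induction I rule: finite_induct)
  case (insert i I)
  have "set_det (A i \<union> (\<Union>j\<in>I. A j)) M = set_det (A i) M * set_det (\<Union>j\<in>I. A j) M"
  proof (rule set_det_Un_lower_zero)
    show "A i \<inter> (\<Union>j\<in>I. A j) = {}"
      using insert.hyps(2) insert.prems(2) [of i] by fastforce
    show "M b a = 0" if "a \<in> A i" "b \<in> (\<Union>j\<in>I. A j)" for a b
      using that insert.hyps(2) insert.prems(3) [of _ i b a] by auto
  qed (use insert in auto)
  also have "set_det (\<Union>j\<in>I. A j) M = (\<Prod>j\<in>I. set_det (A j) M)"
    by (rule insert.IH; use insert.prems in \<open>meson insertI2\<close>)
  finally show ?case
    using insert.hyps by simp
qed simp

text \<open>\<open>W\<close> stands for minus the inverse of the \<open>B\<close> block times the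
  \<open>B\<close>-\<open>A\<close> block, but it only has to solve the linear system in the last
  assumption. Adding the combinations of \<open>B\<close>-columns prescribed by \<open>W\<close> to
  the \<open>A\<close>-columns clears the \<open>B\<close>-\<open>A\<close> block.\<close>

lemma set_det_schur:
  fixes M :: "'a \<Rightarrow> 'a \<Rightarrow> 'c :: idom"
  assumes fin: "finite A" "finite B" and disj: "A \<inter> B = {}"
    and W: "\<And>a b. a \<in> A \<Longrightarrow> b \<in> B \<Longrightarrow> M b a + (\<Sum>b'\<in>B. M b b' * W b' a) = 0"
  shows "set_det (A \<union> B) M =
    set_det A (\<lambda>a a'. M a a' + (\<Sum>b\<in>B. M a b * W b a')) * set_det B M"
proof -
  \<comment> \<open>\<open>L\<close> is unitriangular with \<open>W\<close> below the diagonal, so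
    it has determinant 1, and \<open>K\<close> is the product of \<open>M\<close> and
    \<open>L\<close>.\<close>
  define L where "L a b = (if a = b then 1 else if a \<in> B \<and> b \<in> A then W a b else 0)" for a b
  define K where "K a b = (\<Sum>c\<in>A \<union> B. M a c * L c b)" for a b
  obtain vs where vs: "distinct vs" "set vs = A \<union> B"
    using finite_distinct_list [of "A \<union> B"] fin by blast
  have K_A: "K a b = M a b + (\<Sum>c\<in>B. M a c * W c b)" if "b \<in> A" for a b
  proof -
    have "(\<Sum>c\<in>A. M a c * L c b) = (\<Sum>c\<in>A. if c = b then M a c else 0)"
      using disj that by (intro sum.cong) (auto simp: L_def)
    moreover have "(\<Sum>c\<in>B. M a c * L c b) = (\<Sum>c\<in>B. M a c * W c b)"
      using disj that by (intro sum.cong) (auto simp: L_def)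
    ultimately show ?thesis
      using fin that disj by (simp add: K_def sum.union_disjoint)
  qed
  have K_B: "K a b = M a b" if "b \<in> B" for a b
  proof -
    have "K a b = (\<Sum>c\<in>A \<union> B. if c = b then M a c else 0)"
      unfolding K_def using disj that by (intro sum.cong) (auto simp: L_def)
    then show ?thesis
      using fin that by simp
  qed
  have delta: "set_det C (\<lambda>a b. if a = b then 1 else 0 :: 'c) = 1" if "finite C" for C :: "'a set"
    using finite_distinct_list [OF that] by (auto simp: set_det_eq lmat_delta)
  have L: "set_det (A \<union> B) L = 1"
  proof -
    have "set_det (A \<union> B) L = set_det A L * set_det B L"
      by (rule set_det_Un_upper_zero) (use fin disj in \<open>auto simp: L_def\<close>)
    moreover have "set_det A L = set_det A (\<lambda>a b. if a = b then 1 else 0)"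
      by (rule set_det_cong) (use fin disj in \<open>auto simp: L_def\<close>)
    moreover have "set_det B L = set_det B (\<lambda>a b. if a = b then 1 else 0)"
      by (rule set_det_cong) (use fin disj in \<open>auto simp: L_def\<close>)
    ultimately show ?thesis
      using fin delta by simp
  qed
  have "set_det (A \<union> B) M = set_det (A \<union> B) M * set_det (A \<union> B) L"
    using L by simp
  also have "\<dots> = det (lmat M vs vs * lmat L vs vs)"
    using vs by (simp add: set_det_eq [OF vs] det_mult [of _ "length vs"])
  also have "\<dots> = set_det (A \<union> B) K"
    unfolding lmat_mult [OF vs(1)] vs(2) K_def by (simp add: set_det_eq [OF vs])
  also have "\<dots> = set_det A K * set_det B K"
    by (rule set_det_Un_lower_zero) (use fin disj W K_A in auto)
  also have "set_det A K = set_det A (\<lambda>a a'. M a a' + (\<Sum>b\<in>B. M a b * W b a'))"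
    by (rule set_det_cong) (use fin K_A in auto)
  also have "set_det B K = set_det B M"
    by (rule set_det_cong) (use fin K_B in auto)
  finally show ?thesis .
qed

lemma set_det_singleton: "set_det {u} M = M u u"
proof -
  have "set_det {u} M = det (lmat M [u] [u])"
    by (rule set_det_eq) auto
  then show ?thesis
    by (simp add: lmat_def det_single)
qed

lemma set_det_doubleton:
  assumes "u \<noteq> v"
  shows "set_det {u, v} M = M u u * M v v - M u v * M v u"
proof -
  have "det (lmat M [u, v] [u, v]) = M u u * M v v - M u v * M v u"
    by (subst laplace_expansion_column [of _ 2 0])
      (auto simp: lmat_def numeral_2_eq_2 cofactor_def mat_delete_def det_single algebra_simps)
  then show ?thesis
    using set_det_eq [of "[u, v]" "{u, v}" M] assms by simp
qed

text \<open>The all-ones vector lies in the kernel; it is a nonzero vector because \<open>A\<close>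
  is nonempty.\<close>

lemma set_det_zero_row_sums:
  fixes M :: "'a \<Rightarrow> 'a \<Rightarrow> 'c :: idom"
  assumes "finite A" "A \<noteq> {}" "\<And>a. a \<in> A \<Longrightarrow> (\<Sum>b\<in>A. M a b) = 0"
  shows "set_det A M = 0"
proof -
  obtain vs where vs: "distinct vs" "set vs = A"
    using finite_distinct_list [OF assms(1)] by blast
  let ?w = "vec (length vs) (\<lambda>_. 1 :: 'c)"
  have "(\<Sum>i<length vs. M a (vs ! i)) = (\<Sum>b\<in>A. M a b)" for a
    by (rule sum.reindex_bij_betw) (use vs bij_betw_nth in blast)
  then have "lmat M vs vs *\<^sub>v ?w = 0\<^sub>v (length vs)"
    using assms(3) vs by (auto simp: lmat_def scalar_prod_def atLeast0LessThan intro!: eq_vecI)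
  moreover have "?w \<noteq> 0\<^sub>v (length vs)"
  proof
    assume "?w = 0\<^sub>v (length vs)"
    then have "?w $ 0 = (0\<^sub>v (length vs) :: 'c vec) $ 0"
      by simp
    with vs assms(2) show False
      by (cases vs) auto
  qed
  ultimately have "det (lmat M vs vs) = 0"
    unfolding det_0_iff_vec_prod_zero [OF lmat_carrier] by (meson vec_carrier)
  then show ?thesis
    using vs by (simp add: set_det_eq)
qed

subsection \<open>Characteristic polynomials\<close>

text \<open>The choice term is the one used by \<open>vertex_list\<close>, so that
  \<open>Q_spectrum_eq\<close> follows by unfolding.\<close>

definition set_char_poly :: "'a set \<Rightarrow> ('a \<Rightarrow> 'a \<Rightarrow> 'c :: field) \<Rightarrow> 'c poly" where
  "set_char_poly A M = (let vs = (SOME vs. distinct vs \<and> set vs = A) in char_poly (lmat M vs vs))"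

lemma
  assumes "finite A"
  shows poly_set_char_poly:
      "poly (set_char_poly A M) x = set_det A (\<lambda>a b. (if a = b then x else 0) - M a b)"
    and set_char_poly_nonzero: "set_char_poly A M \<noteq> 0"
proof -
  define vs where "vs = (SOME vs. distinct vs \<and> set vs = A)"
  have "distinct vs \<and> set vs = A"
    unfolding vs_def by (rule someI_ex) (use finite_distinct_list [OF assms] in blast)
  then have vs: "distinct vs" "set vs = A"
    by auto
  have cp: "set_char_poly A M = char_poly (lmat M vs vs)"
    unfolding set_char_poly_def vs_def Let_def by (rule refl)
  \<comment> \<open>\<open>char_matrix A x\<close> is A - x I, hence the minus sign.\<close>
  have "- char_matrix (lmat M vs vs) x = lmat (\<lambda>a b. (if a = b then x else 0) - M a b) vs vs"
    using vs by (auto simp: char_matrix_def lmat_def nth_eq_iff_index_eq intro!: eq_matI)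
  then show "poly (set_char_poly A M) x = set_det A (\<lambda>a b. (if a = b then x else 0) - M a b)"
    unfolding cp set_det_eq [OF vs] by (simp only: char_poly_matrix [OF lmat_carrier])
  have *: "degree (char_poly (lmat M vs vs)) = length vs \<and> coeff (char_poly (lmat M vs vs)) (length vs) = 1"
    by (rule degree_monic_char_poly) simp
  show "set_char_poly A M \<noteq> 0"
    using * unfolding cp by force
qed

text \<open>The eigenvalues of a real symmetric matrix are real, so its characteristic polynomial
  splits over the reals and \<open>proots\<close> misses none of them. This is what makes counting
  the remaining eigenvalues possible.\<close>

lemma size_proots_char_poly_symmetric:
  fixes A :: "real mat"
  assumes A: "A \<in> carrier_mat n n" and sym: "\<And>i j. i < n \<Longrightarrow> j < n \<Longrightarrow> A $$ (i, j) = A $$ (j, i)"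
  shows "size (proots (char_poly A)) = n"
proof -
  define B where "B = map_mat complex_of_real A"
  have B: "B \<in> carrier_mat n n"
    using A by (simp add: B_def)
  obtain as where as: "char_poly B = (\<Prod>a\<leftarrow>as. [:- a, 1:])" "length as = n"
    using char_poly_factorized [OF B] by blast
  have real: "a \<in> \<real>" if "a \<in> set as" for a
  proof -
    have "poly (char_poly B) a = 0"
      using that by (auto simp: as(1) poly_prod_list prod_list_zero_iff)
    then have "eigenvalue B a"
      using eigenvalue_root_char_poly [OF B] by blast
    then obtain w where w: "w \<in> carrier_vec n" "w \<noteq> 0\<^sub>v n" "B *\<^sub>v w = a \<cdot>\<^sub>v w"
      using B unfolding eigenvalue_def eigenvector_def by auto
    \<comment> \<open>The Hermitian form w* A w: symmetry makes it equal to its conjugate, while the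
      eigenvector equation makes it \<open>a\<close> times the squared norm of
      \<open>w\<close>.\<close>
    define S where "S = (\<Sum>i<n. cnj (w $ i) * (\<Sum>j<n. of_real (A $$ (i, j)) * w $ j))"
    have row: "(\<Sum>j<n. of_real (A $$ (i, j)) * w $ j) = a * w $ i" if "i < n" for i
    proof -
      have "(B *\<^sub>v w) $ i = a * w $ i"
        using w that by simp
      then show ?thesis
        using that A w by (simp add: B_def scalar_prod_def atLeast0LessThan)
    qed
    have "S = (\<Sum>i<n. \<Sum>j<n. cnj (w $ i) * of_real (A $$ (i, j)) * w $ j)"
      by (simp add: S_def sum_distrib_left mult.assoc)
    moreover have "cnj S = (\<Sum>i<n. \<Sum>j<n. w $ i * of_real (A $$ (i, j)) * cnj (w $ j))"
      by (simp add: S_def sum_distrib_left mult.assoc)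
    moreover have "\<dots> = (\<Sum>j<n. \<Sum>i<n. w $ i * of_real (A $$ (i, j)) * cnj (w $ j))"
      by (rule sum.swap)
    moreover have "\<dots> = (\<Sum>i<n. \<Sum>j<n. cnj (w $ i) * of_real (A $$ (i, j)) * w $ j)"
      by (intro sum.cong refl) (metis (no_types, opaque_lifting) lessThan_iff mult.assoc mult.commute sym)
    ultimately have "S \<in> \<real>"
      by (simp add: Reals_cnj_iff)
    have "S = (\<Sum>i<n. cnj (w $ i) * (a * w $ i))"
      unfolding S_def using row by simp
    also have "\<dots> = a * of_real (\<Sum>i<n. (cmod (w $ i))\<^sup>2)"
      unfolding of_real_sum sum_distrib_left
      by (intro sum.cong refl) (simp add: complex_norm_square mult_ac del: of_real_power)
    finally have S: "S = a * of_real (\<Sum>i<n. (cmod (w $ i))\<^sup>2)" .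
    have "(\<Sum>i<n. (cmod (w $ i))\<^sup>2) \<noteq> 0"
    proof
      assume "(\<Sum>i<n. (cmod (w $ i))\<^sup>2) = 0"
      then have "w = 0\<^sub>v n"
        using w(1) by (auto simp: sum_nonneg_eq_0_iff intro!: eq_vecI)
      with w(2) show False by blast
    qed
    then have "a = S / of_real (\<Sum>i<n. (cmod (w $ i))\<^sup>2)"
      using S by (metis nonzero_mult_div_cancel_right of_real_eq_0_iff)
    with \<open>S \<in> \<real>\<close> show ?thesis
      by (metis Reals_divide Reals_of_real)
  qed
  interpret m: map_poly_comm_ring_hom complex_of_real ..
  \<comment> \<open>The complex factorization has real roots, so it is the image of a real one, and
    the embedding of coefficients is injective.\<close>
  have "map_poly complex_of_real (char_poly A) = char_poly B"
    unfolding B_def by (rule of_real_hom.char_poly_hom [OF A, symmetric])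
  also note as(1)
  also have "(\<Prod>a\<leftarrow>as. [:- a, 1:]) = map_poly complex_of_real (\<Prod>a\<leftarrow>as. [:- Re a, 1:])"
    using real
  proof (induction as)
    case (Cons a as)
    then have "of_real (Re a) = a"
      by (simp add: of_real_Re)
    then have "map_poly complex_of_real [:- Re a, 1:] = [:- a, 1:]"
      by (simp add: map_poly_pCons)
    moreover have "(\<Prod>a\<leftarrow>as. [:- a, 1:]) = map_poly complex_of_real (\<Prod>a\<leftarrow>as. [:- Re a, 1:])"
      by (rule Cons.IH) (use Cons.prems in auto)
    ultimately show ?case
      by (simp only: list.map prod_list.Cons m.hom_mult)
  qed simp
  finally have "char_poly A = (\<Prod>a\<leftarrow>as. [:- Re a, 1:])"
    by (simp add: poly_eq_iff coeff_map_poly)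
  \<comment> \<open>\<open>proots\<close> is additive on a product only when the product is
    nonzero.\<close>
  moreover have "(\<Prod>a\<leftarrow>bs. [:- Re a, 1:]) \<noteq> 0" for bs
    by (induction bs) (simp_all del: mult_pCons_left)
  then have "size (proots (\<Prod>a\<leftarrow>bs. [:- Re a, 1:])) = length bs" for bs
    by (induction bs) (simp_all add: proots_mult del: mult_pCons_left)
  ultimately show ?thesis
    using as(2) by simp
qed

text \<open>The eliminations below divide by x - c and so give identities only for x different from
  c. Multiplying the difference by x - c covers the missing point, and this factor cancels.\<close>

lemma poly_eqI_off_point:
  fixes p q :: "real poly"
  assumes "\<And>x. x \<noteq> c \<Longrightarrow> poly p x = poly q x"
  shows "p = q"
proof -
  have "poly ([:- c, 1:] * (p - q)) x = poly 0 x" for x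
    using assms [of x] by auto
  then have "[:- c, 1:] * (p - q) = 0"
    by (simp only: poly_eq_poly_eq_iff [symmetric] fun_eq_iff) simp
  then show ?thesis
    by (simp del: mult_pCons_left)
qed

subsection \<open>Graphs and their signless Laplacian\<close>

lemma edge_endpoints_distinct: "simple_graph X \<Longrightarrow> {x, y} \<in> edges X \<Longrightarrow> x \<noteq> y"
  by (force simp: simple_graph_def)

lemma edge_endpoints_verts:
  assumes "simple_graph X" "{x, y} \<in> edges X"
  shows "x \<in> verts X" "y \<in> verts X"
  using assms by (auto simp: simple_graph_def)

lemma finite_verts [simp]: "simple_graph X \<Longrightarrow> finite (verts X)"
  by (simp add: simple_graph_def)

lemma vertex_degree_eq_card_neighbours:
  assumes "simple_graph X"
  shows "vertex_degree X x = card {y. {x, y} \<in> edges X}"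
proof -
  have "{e \<in> edges X. x \<in> e} = (\<lambda>y. {x, y}) ` {y. {x, y} \<in> edges X}"
  proof (intro equalityI subsetI)
    fix e assume "e \<in> {e \<in> edges X. x \<in> e}"
    then have e: "e \<in> edges X" "x \<in> e" "card e = 2"
      using assms by (auto simp: simple_graph_def)
    then obtain y where "e = {x, y}"
      by (auto simp: card_2_iff)
    with e show "e \<in> (\<lambda>y. {x, y}) ` {y. {x, y} \<in> edges X}"
      by blast
  qed auto
  moreover have "inj_on (\<lambda>y. {x, y}) {y. {x, y} \<in> edges X}"
    by (auto simp: inj_on_def doubleton_eq_iff)
  ultimately show ?thesis
    by (simp add: vertex_degree_def card_image)
qed

definition Q_entry :: "'a sgraph \<Rightarrow> 'a \<Rightarrow> 'a \<Rightarrow> real" where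
  "Q_entry X x y =
     (if x = y then real (vertex_degree X x) else if {x, y} \<in> edges X then 1 else 0)"

lemma
  assumes "simple_graph X"
  shows distinct_vertex_list: "distinct (vertex_list X)"
    and set_vertex_list: "set (vertex_list X) = verts X"
proof -
  have "distinct (vertex_list X) \<and> set (vertex_list X) = verts X"
    unfolding vertex_list_def
    by (rule someI_ex) (use finite_distinct_list [OF finite_verts [OF assms]] in blast)
  then show "distinct (vertex_list X)" "set (vertex_list X) = verts X"
    by auto
qed

lemma signless_laplacian_eq_lmat:
  assumes "simple_graph X"
  shows "signless_laplacian X = lmat (Q_entry X) (vertex_list X) (vertex_list X)"
proof -
  \<comment> \<open>Without loops the adjacency matrix has zero diagonal, so the cases in
    \<open>Q_entry\<close> do not overlap.\<close>
  have "{x} \<notin> edges X" for x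
    using edge_endpoints_distinct [OF assms, of x x] by auto
  then show ?thesis
    using distinct_vertex_list [OF assms]
    by (auto simp: signless_laplacian_def degree_matrix_def adjacency_matrix_def lmat_def
        Q_entry_def Let_def nth_eq_iff_index_eq intro!: eq_matI)
qed

lemma Q_spectrum_eq:
  assumes "simple_graph X"
  shows "Q_spectrum X = proots (set_char_poly (verts X) (Q_entry X))"
  unfolding Q_spectrum_def signless_laplacian_eq_lmat [OF assms]
  by (simp add: set_char_poly_def vertex_list_def Let_def)

lemma neighbours_delete_verts:
  assumes "x \<notin> S"
  shows "{y. {x, y} \<in> edges (delete_verts X S)} = {y. {x, y} \<in> edges X} - S"
  using assms by (auto simp: delete_verts_def)

lemma simple_graph_delete_verts: "simple_graph X \<Longrightarrow> simple_graph (delete_verts X S)"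
  by (auto simp: simple_graph_def delete_verts_def)

text \<open>The neighbourhood is contained in \<open>verts X - {x}\<close> and has the same finite
  cardinality.\<close>

lemma neighbours_of_full_degree:
  assumes "simple_graph X" "x \<in> verts X" "vertex_degree X x = card (verts X) - 1"
  shows "{y. {x, y} \<in> edges X} = verts X - {x}"
proof (rule card_subset_eq)
  show "{y. {x, y} \<in> edges X} \<subseteq> verts X - {x}"
    using edge_endpoints_verts [OF assms(1)] edge_endpoints_distinct [OF assms(1)] by blast
  show "card {y. {x, y} \<in> edges X} = card (verts X - {x})"
    using assms vertex_degree_eq_card_neighbours [OF assms(1), of x] by simp
qed (use assms in auto)

lemma size_Q_spectrum:
  assumes "simple_graph X"
  shows "size (Q_spectrum X) = card (verts X)"
proof -
  have "size (Q_spectrum X) = length (vertex_list X)"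
    unfolding Q_spectrum_def signless_laplacian_eq_lmat [OF assms]
    by (rule size_proots_char_poly_symmetric) (auto simp: lmat_def Q_entry_def insert_commute)
  also have "\<dots> = card (verts X)"
    using distinct_card [OF distinct_vertex_list [OF assms]] set_vertex_list [OF assms] by simp
  finally show ?thesis .
qed

subsection \<open>Edge pockets\<close>

locale edge_pocket_graph =
  fixes H :: "'b sgraph" and u v :: 'b and m r\<^sub>2 :: nat
  assumes m_ge_3: "m \<ge> 3" and edge_pocket: "edge_pocket H u v m r\<^sub>2"
begin

definition interior :: "'b set" where
  "interior = verts H - {u, v}"

definition c :: real where
  "c = 2 * real r\<^sub>2 + 2"

definition h :: real where
  "h = real m - 2"

lemma simple_H: "simple_graph H"
  and card_H: "card (verts H) = m"
  and uv_edge: "{u, v} \<in> edges H"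
  using edge_pocket by (auto simp: edge_pocket_def)

lemma u_neq_v: "u \<noteq> v"
  using edge_endpoints_distinct [OF simple_H uv_edge] .

lemma u_v_verts: "u \<in> verts H" "v \<in> verts H"
  using edge_endpoints_verts [OF simple_H uv_edge] .

lemma verts_H: "verts H = {u, v} \<union> interior"
  using u_v_verts by (auto simp: interior_def)

lemma finite_interior [simp]: "finite interior"
  using simple_H by (simp add: interior_def)

lemma not_interior [simp]: "u \<notin> interior" "v \<notin> interior"
  by (auto simp: interior_def)

lemma card_interior: "card interior = m - 2" "real (card interior) = h"
proof -
  show "card interior = m - 2"
    using card_H u_v_verts u_neq_v simple_H by (simp add: interior_def card_Diff_subset)
  then show "real (card interior) = h"
    using m_ge_3 by (simp add: h_def of_nat_diff)
qed

lemma degree_u_v: "vertex_degree H u = m - 1" "vertex_degree H v = m - 1"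
  using edge_pocket by (auto simp: edge_pocket_def)

lemma u_v_neighbours:
  "{u, y} \<in> edges H \<longleftrightarrow> y \<in> verts H - {u}" "{v, y} \<in> edges H \<longleftrightarrow> y \<in> verts H - {v}"
  using neighbours_of_full_degree [OF simple_H u_v_verts(1)]
    neighbours_of_full_degree [OF simple_H u_v_verts(2)] degree_u_v card_H by auto

lemma interior_neighbours:
  assumes "y \<in> interior"
  shows "{y'. {y, y'} \<in> edges H} = {u, v} \<union> {y' \<in> interior. {y, y'} \<in> edges H}"
proof -
  have "{y, u} \<in> edges H" "{y, v} \<in> edges H"
    using assms u_v_neighbours [of y] by (simp_all add: interior_def insert_commute [of y])
  moreover have "y' \<in> {u, v} \<union> interior" if "{y, y'} \<in> edges H" for y'
    using edge_endpoints_verts(2) [OF simple_H that] verts_H by simp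
  ultimately show ?thesis
    by auto
qed

lemma card_interior_neighbours:
  assumes "y \<in> interior"
  shows "card {y' \<in> interior. {y, y'} \<in> edges H} = r\<^sub>2"
proof -
  let ?D = "delete_verts H {u, v}"
  have "y \<in> verts ?D" "y \<notin> {u, v}"
    using assms by (auto simp: delete_verts_def interior_def)
  then have "card {y'. {y, y'} \<in> edges ?D} = r\<^sub>2"
    using edge_pocket vertex_degree_eq_card_neighbours [OF simple_graph_delete_verts [OF simple_H], of "{u, v}" y]
    by (simp add: edge_pocket_def regular_def)
  moreover have "{y'. {y, y'} \<in> edges ?D} = {y' \<in> interior. {y, y'} \<in> edges H}"
    unfolding neighbours_delete_verts [OF \<open>y \<notin> {u, v}\<close>] interior_neighbours [OF assms] by auto
  ultimately show ?thesis
    by simp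
qed

lemma degree_interior:
  assumes "y \<in> interior"
  shows "vertex_degree H y = r\<^sub>2 + 2"
proof -
  have "vertex_degree H y = card ({u, v} \<union> {y' \<in> interior. {y, y'} \<in> edges H})"
    by (simp only: vertex_degree_eq_card_neighbours [OF simple_H] interior_neighbours [OF assms])
  also have "\<dots> = card {u, v} + card {y' \<in> interior. {y, y'} \<in> edges H}"
    by (rule card_Un_disjoint) auto
  finally show ?thesis
    using u_neq_v card_interior_neighbours [OF assms] by simp
qed

text \<open>The diagonal contributes the degree in \<open>H\<close>, which counts \<open>u\<close>
  and \<open>v\<close> as well, and the interior neighbours contribute \<open>r\<^sub>2\<close>
  more.\<close>

lemma interior_row_sum:
  assumes "y \<in> interior"
  shows "(\<Sum>y'\<in>interior. Q_entry H y y') = c"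
proof -
  have "(\<Sum>y'\<in>interior. Q_entry H y y') =
      (\<Sum>y'\<in>interior. (if y' = y then real (r\<^sub>2 + 2) else 0) + (if {y, y'} \<in> edges H then 1 else 0))"
    using degree_interior [OF assms] edge_endpoints_distinct [OF simple_H, of y y]
    by (intro sum.cong refl) (auto simp: Q_entry_def)
  also have "\<dots> = real (r\<^sub>2 + 2) + real (card {y' \<in> interior. {y, y'} \<in> edges H})"
    using assms by (simp add: sum.distrib flip: sum.inter_filter)
  finally show ?thesis
    using card_interior_neighbours [OF assms] by (simp add: c_def)
qed

lemma interior_char_row_sum:
  assumes "y \<in> interior"
  shows "(\<Sum>y'\<in>interior. (if y = y' then x else 0) - Q_entry H y y') = x - c"
  using assms interior_row_sum [OF assms] by (simp add: sum_subtractf)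

section \<open>Factorization of the characteristic polynomial of the pocket\<close>

definition interior_poly :: "real poly" where
  "interior_poly = set_char_poly interior (Q_entry H)"

definition reduced_poly :: "real poly" where
  "reduced_poly = interior_poly div [:- c, 1:]"

text \<open>At x = c the rows of the characteristic matrix of the interior sum to 0, so c is a root
  and the division is exact. The interior is nonempty since m is at least 3.\<close>

lemma interior_poly_eq: "interior_poly = [:- c, 1:] * reduced_poly"
proof -
  have "poly interior_poly c = 0"
    unfolding interior_poly_def poly_set_char_poly [OF finite_interior]
  proof (rule set_det_zero_row_sums)
    show "interior \<noteq> {}"
      using card_interior(1) m_ge_3 by auto
  qed (simp_all only: finite_interior interior_char_row_sum diff_self)
  then have "[:- c, 1:] dvd interior_poly"
    by (simp add: poly_eq_0_iff_dvd)
  then show ?thesis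
    unfolding reduced_poly_def by (rule dvd_mult_div_cancel [symmetric])
qed

lemma poly_interior_poly: "poly interior_poly x = set_det interior (\<lambda>y y'. (if y = y' then x else 0) - Q_entry H y y')"
  by (simp add: interior_poly_def poly_set_char_poly)

lemma reduced_poly_nonzero: "reduced_poly \<noteq> 0"
  using set_char_poly_nonzero [OF finite_interior, of "Q_entry H"] interior_poly_eq by (auto simp: interior_poly_def)

text \<open>Schur elimination of the interior with \<open>W\<close> constantly 1 / (x - c) leaves a
  2 by 2 determinant over \<open>u\<close> and \<open>v\<close>.\<close>

lemma char_poly_H:
  "set_char_poly (verts H) (Q_entry H) =
     reduced_poly * ([:- h, 1:] * ([:- c, 1:] * [:- real m, 1:] - [:2 * h:]))" (is "?l = ?r")
proof (rule poly_eqI_off_point)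
  fix x assume x: "x \<noteq> c"
  let ?M = "\<lambda>a b. (if a = b then x else 0) - Q_entry H a b"
  have M: "?M a b = - 1" "?M b a = - 1" if "b \<in> interior" "a \<in> {u, v}" for a b
    using that u_v_neighbours [of b] by (auto simp: Q_entry_def interior_def insert_commute [of b])
  let ?N = "\<lambda>a a'. ?M a a' + (\<Sum>b\<in>interior. ?M a b * (1 / (x - c)))"
  have "poly ?l x = set_det ({u, v} \<union> interior) ?M"
    by (simp add: poly_set_char_poly verts_H)
  also have "\<dots> = set_det {u, v} ?N * set_det interior ?M"
  proof (rule set_det_schur)
    fix a b assume ab: "a \<in> {u, v}" "b \<in> interior"
    have "(\<Sum>b'\<in>interior. ?M b b' * (1 / (x - c))) = (\<Sum>b'\<in>interior. ?M b b') * (1 / (x - c))"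
      by (rule sum_distrib_right [symmetric])
    also have "\<dots> = 1"
      unfolding interior_char_row_sum [OF ab(2)] using x by simp
    finally show "?M b a + (\<Sum>b'\<in>interior. ?M b b' * (1 / (x - c))) = 0"
      using M(2) [OF ab(2,1)] by simp
  qed auto
  also have "set_det {u, v} ?N = ?N u u * ?N v v - ?N u v * ?N v u"
    by (rule set_det_doubleton) (rule u_neq_v)
  \<comment> \<open>The 2 by 2 matrix has equal diagonal entries and equal off-diagonal entries, so
    its determinant is their difference, x - h, times their sum.\<close>
  also have "\<dots> = (x - h) * (x - real m - 2 * (h / (x - c)))"
  proof -
    have s: "(\<Sum>b\<in>interior. ?M a b * (1 / (x - c))) = - (h / (x - c))" if "a \<in> {u, v}" for a
      using M(1) [OF _ that] card_interior(2) by simp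
    have uv: "Q_entry H u u = h + 1" "Q_entry H v v = h + 1" "Q_entry H u v = 1" "Q_entry H v u = 1"
      using degree_u_v m_ge_3 u_neq_v uv_edge
      by (auto simp: Q_entry_def h_def of_nat_diff insert_commute)
    have m: "real m = h + 2"
      by (simp add: h_def)
    \<comment> \<open>With the fraction hidden behind \<open>t\<close> the identity is a polynomial
      one.\<close>
    obtain t where t: "h / (x - c) = t"
      by blast
    show ?thesis
      unfolding s [OF insertI1] s [OF insertI2 [OF singletonI]] uv m t
      using u_neq_v by (simp add: field_simps)
  qed
  also have "\<dots> * set_det interior ?M = (x - h) * (x - real m - 2 * (h / (x - c))) * ((x - c) * poly reduced_poly x)"
    unfolding poly_interior_poly [symmetric] interior_poly_eq by (simp add: left_diff_distrib)
  also have "\<dots> = poly ?r x"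
    using x by (simp add: field_simps)
  finally show "poly ?l x = poly ?r x" .
qed

text \<open>The assumption gives only the set of roots, whereas the spectrum needs multiplicities;
  so the quadratic is shown to factor as (x - \<zeta>)(x - \<eta>).\<close>

lemma Q_spectrum_H_eq:
  assumes "{x. (x - 2 * real r\<^sub>2 - 2) * (x - real m) - 2 * (real m - 2) = 0} = {\<zeta>, \<eta>}"
  shows "Q_spectrum H = proots reduced_poly + {#real m - 2, \<zeta>, \<eta>#}"
proof -
  have root: "(x - c) * (x - real m) - 2 * h = 0 \<longleftrightarrow> x \<in> {\<zeta>, \<eta>}" for x
    unfolding assms [symmetric] c_def h_def by (simp add: algebra_simps)
  have h: "h > 0"
    using m_ge_3 by (simp add: h_def)
  have z: "(\<zeta> - c) * (\<zeta> - real m) = 2 * h"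
    using root [of \<zeta>] by simp
  \<comment> \<open>By Vieta c + m - \<zeta> is also a root. It differs from \<zeta>, since a double
    root would make 2 h minus a square.\<close>
  have sum: "\<eta> = c + real m - \<zeta>"
  proof -
    have "c + real m - \<zeta> \<in> {\<zeta>, \<eta>}"
      unfolding root [symmetric] using z by (simp add: algebra_simps)
    moreover have "c + real m - \<zeta> \<noteq> \<zeta>"
    proof
      assume "c + real m - \<zeta> = \<zeta>"
      then have "\<zeta> - real m = - (\<zeta> - c)"
        by simp
      then have "- ((\<zeta> - c) * (\<zeta> - c)) = 2 * h"
        using z by (simp only: mult_minus_right)
      with h zero_le_square [of "\<zeta> - c"] show False
        by linarith
    qed
    ultimately show ?thesis
      by auto
  qed
  have "[:- c, 1:] * [:- real m, 1:] - [:2 * h:] = [:- \<zeta>, 1:] * [:- \<eta>, 1:]"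
    using z unfolding sum by (simp add: algebra_simps)
  then have "Q_spectrum H = proots (reduced_poly * ([:- h, 1:] * ([:- \<zeta>, 1:] * [:- \<eta>, 1:])))"
    by (simp only: Q_spectrum_eq [OF simple_H] char_poly_H)
  also have "\<dots> = proots reduced_poly + {#real m - 2, \<zeta>, \<eta>#}"
    using reduced_poly_nonzero by (simp add: proots_mult h_def del: mult_pCons_left mult_pCons_right)
  finally show ?thesis .
qed

text \<open>One copy of each exceptional value is removed, so further occurrences among the roots of
  \<open>reduced_poly\<close> survive.\<close>

lemma Q_spectrum_H:
  assumes "{x. (x - 2 * real r\<^sub>2 - 2) * (x - real m) - 2 * (real m - 2) = 0} = {\<zeta>, \<eta>}"
  shows "Q_spectrum H - {#real m - 2, \<zeta>, \<eta>#} = proots reduced_poly"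
  by (simp add: Q_spectrum_H_eq [OF assms])

end

subsection \<open>Graphs with edge pockets\<close>

text \<open>The quotient of Q(G) in which the interior over each edge is one cell. Entries are
  column sums over cells, hence \<open>h\<close> from a vertex into a pocket and 1 back; the row-sum
  convention would give the transpose.\<close>

definition pocket_quotient ::
  "'a sgraph \<Rightarrow> 'a set set \<Rightarrow> real \<Rightarrow> real \<Rightarrow> 'a + 'a set \<Rightarrow> 'a + 'a set \<Rightarrow> real" where
  "pocket_quotient F E h c z w =
     (case (z, w) of
        (Inl a, Inl b) \<Rightarrow> if a = b then real (vertex_degree F a) + h * real (card {e \<in> E. a \<in> e})
                           else if {a, b} \<in> edges F then 1 else 0
      | (Inl a, Inr e) \<Rightarrow> if a \<in> e then 1 else 0
      | (Inr e, Inl a) \<Rightarrow> if a \<in> e then h else 0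
      | (Inr e, Inr e') \<Rightarrow> if e = e' then c else 0)"

lemma poly_char_poly_pocket_quotient:
  fixes V :: "'a set" and E :: "'a set set" and x :: real
  assumes "finite V" "finite E" "x \<noteq> c"
  shows "poly (set_char_poly (Inl ` V \<union> Inr ` E) (pocket_quotient F E h c)) x =
    set_det V (\<lambda>a a'. (if a = a' then x - vertex_degree F a - h * card {e \<in> E. a \<in> e}
        else if {a, a'} \<in> edges F then - 1 else 0) - h / (x - c) * card {e \<in> E. a \<in> e \<and> a' \<in> e})
      * (x - c) ^ card E"
proof -
  let ?M = "\<lambda>z w. (if z = w then x else 0) - pocket_quotient F E h c z w"
  let ?W = "\<lambda>w z :: 'a + 'a set. (case (w, z) of (Inr e, Inl a) \<Rightarrow> (if a \<in> e then h / (x - c) else 0) | _ \<Rightarrow> 0)"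
  let ?B = "Inr ` E :: ('a + 'a set) set"
  have sum_B: "(\<Sum>b\<in>?B. f b) = (\<Sum>e\<in>E. f (Inr e))" for f :: "'a + 'a set \<Rightarrow> real"
    by (subst sum.reindex) auto
  have diag: "?M (Inr e) (Inr e') = (if e = e' then x - c else 0)" for e e'
    by (simp add: pocket_quotient_def)
  have "poly (set_char_poly (Inl ` V \<union> ?B) (pocket_quotient F E h c)) x = set_det (Inl ` V \<union> ?B) ?M"
    using assms by (simp add: poly_set_char_poly)
  also have "\<dots> = set_det (Inl ` V) (\<lambda>a a'. ?M a a' + (\<Sum>b\<in>?B. ?M a b * ?W b a')) * set_det ?B ?M"
  proof (rule set_det_schur)
    fix z w :: "'a + 'a set" assume "z \<in> Inl ` V" "w \<in> ?B"
    then obtain a e where zw: "z = Inl a" "w = Inr e" "e \<in> E"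
      by auto
    have "(\<Sum>b'\<in>?B. ?M w b' * ?W b' z) =
        (\<Sum>e'\<in>E. if e' = e then (x - c) * (if a \<in> e then h / (x - c) else 0) else 0)"
      unfolding sum_B zw(1,2) diag by (intro sum.cong refl) auto
    also have "\<dots> = (if a \<in> e then h else 0)"
      using assms zw(3) by simp
    finally show "?M w z + (\<Sum>b'\<in>?B. ?M w b' * ?W b' z) = 0"
      by (simp add: zw(1,2) pocket_quotient_def)
  qed (use assms in auto)
  also have "set_det (Inl ` V) (\<lambda>a a'. ?M a a' + (\<Sum>b\<in>?B. ?M a b * ?W b a')) =
      set_det V (\<lambda>a a'. (if a = a' then x - vertex_degree F a - h * card {e \<in> E. a \<in> e}
        else if {a, a'} \<in> edges F then - 1 else 0) - h / (x - c) * card {e \<in> E. a \<in> e \<and> a' \<in> e})"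
    (is "_ = set_det _ ?R")
  proof (subst set_det_image)
    have "(\<Sum>b\<in>?B. ?M (Inl a) b * ?W b (Inl a')) = - (h / (x - c)) * card {e \<in> E. a \<in> e \<and> a' \<in> e}" for a a'
    proof -
      have "(\<Sum>b\<in>?B. ?M (Inl a) b * ?W b (Inl a')) =
          (\<Sum>e\<in>E. if a \<in> e \<and> a' \<in> e then - (h / (x - c)) else 0)"
        unfolding sum_B by (intro sum.cong refl) (auto simp: pocket_quotient_def)
      then show ?thesis
        using assms by (simp flip: sum.inter_filter)
    qed
    then show "set_det V (\<lambda>a b. ?M (Inl a) (Inl b) + (\<Sum>b'\<in>?B. ?M (Inl a) b' * ?W b' (Inl b))) =
        set_det V ?R"
      using assms by (intro set_det_cong) (auto simp: pocket_quotient_def)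
  qed (use assms in auto)
  also have "set_det ?B ?M = (\<Prod>e\<in>E. set_det {Inr e} ?M)"
  proof -
    have "?B = (\<Union>e\<in>E. {Inr e})"
      by auto
    then show ?thesis
      by (simp only:) (rule set_det_UN_diagonal; use assms in \<open>auto simp: pocket_quotient_def\<close>)
  qed
  also have "\<dots> = (x - c) ^ card E"
    by (simp add: set_det_singleton pocket_quotient_def)
  finally show ?thesis .
qed

locale pocketed_graph = edge_pocket_graph H u v m r\<^sub>2
  for H :: "'b sgraph" and u v m r\<^sub>2 +
  fixes F :: "'a sgraph" and E :: "'a set set" and p :: "'a set \<Rightarrow> 'a \<times> 'a"
  assumes simple_F: "simple_graph F" and E_edges: "E \<subseteq> edges F" and orient: "orientation E p"
begin

abbreviation G :: "('a + 'a set \<times> 'b) sgraph" where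
  "G \<equiv> pocket_graph F E p H u v"

abbreviation pst :: "'a set \<Rightarrow> 'b \<Rightarrow> 'a + 'a set \<times> 'b" where
  "pst \<equiv> paste p u v"

lemma finite_E: "finite E"
proof (rule finite_subset)
  show "E \<subseteq> Pow (verts F)"
    using E_edges simple_F by (auto simp: simple_graph_def)
  show "finite (Pow (verts F))"
    using simple_F by simp
qed

lemma orient_edge: "e \<in> E \<Longrightarrow> e = {fst (p e), snd (p e)}"
  using orient by (auto simp: orientation_def)

lemma card_edge: "e \<in> E \<Longrightarrow> card e = 2"
  using E_edges simple_F by (auto simp: simple_graph_def)

lemma edge_subset: "e \<in> E \<Longrightarrow> e \<subseteq> verts F"
  using E_edges simple_F by (auto simp: simple_graph_def)

lemma ends_distinct:
  assumes "e \<in> E"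
  shows "fst (p e) \<noteq> snd (p e)"
proof -
  have "card {fst (p e), snd (p e)} = 2"
    by (subst orient_edge [OF assms, symmetric]) (rule card_edge [OF assms])
  then show ?thesis
    by (auto simp: card_insert_if split: if_splits)
qed

section \<open>Vertices, edges and degrees of the pocket graph\<close>

lemma paste_simps [simp]:
  "pst e u = Inl (fst (p e))" "pst e v = Inl (snd (p e))"
  "y \<in> interior \<Longrightarrow> pst e y = Inr (e, y)"
  using u_neq_v by (auto simp: paste_def interior_def)

lemma paste_inj:
  assumes "e \<in> E"
  shows "pst e x = pst e y \<longleftrightarrow> x = y"
  using ends_distinct [OF assms] by (auto simp: paste_def)

lemma verts_G: "verts G = Inl ` verts F \<union> Inr ` (E \<times> interior)"
proof -
  have "pst e ` verts H = Inl ` e \<union> Inr ` ({e} \<times> interior)" if "e \<in> E" for e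
  proof -
    have "pst e ` verts H = {Inl (fst (p e)), Inl (snd (p e))} \<union> pst e ` interior"
      by (simp add: verts_H)
    also have "pst e ` interior = Inr ` ({e} \<times> interior)"
      by force
    also have "{Inl (fst (p e)), Inl (snd (p e))} = Inl ` e"
      \<comment> \<open>Only the last occurrence of \<open>e\<close> is expanded; the first two sit
        inside \<open>p e\<close>.\<close>
      by (subst (3) orient_edge [OF that]) simp
    finally show ?thesis .
  qed
  then have "verts G = Inl ` verts F \<union> (\<Union>e\<in>E. Inl ` e \<union> Inr ` ({e} \<times> interior))"
    by (simp add: pocket_graph_def)
  also have "\<dots> = Inl ` verts F \<union> Inr ` (E \<times> interior)"
    using edge_subset by blast
  finally show ?thesis .
qed

lemma simple_G: "simple_graph G"
  unfolding simple_graph_def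
proof (intro conjI ballI)
  show "finite (verts G)"
    using finite_E simple_F by (simp add: verts_G)
next
  fix f assume "f \<in> edges G"
  then consider (old) f' where "f' \<in> edges F" "f = Inl ` f'"
    | (new) e f' where "e \<in> E" "f' \<in> edges H" "f = pst e ` f'"
    by (auto simp: pocket_graph_def)
  then have "f \<subseteq> verts G \<and> card f = 2"
  proof cases
    case old
    then have "f' \<subseteq> verts F" "card f' = 2"
      using simple_F by (auto simp: simple_graph_def)
    then show ?thesis
      using old by (simp add: verts_G card_image le_supI1 image_mono)
  next
    case new
    then have "f' \<subseteq> verts H" "card f' = 2"
      using simple_H by (auto simp: simple_graph_def)
    moreover have "inj_on (pst e) f'"
      using paste_inj [OF new(1)] by (simp add: inj_on_def)
    ultimately show ?thesis
      using new by (auto simp: pocket_graph_def card_image)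
  qed
  then show "f \<subseteq> verts G" "card f = 2"
    by auto
qed

text \<open>Edges are images of unordered pairs; this form names the preimages in the order of
  \<open>z\<close> and \<open>w\<close>, as case analysis on endpoints requires.\<close>

lemma edge_G_iff:
  "{z, w} \<in> edges G \<longleftrightarrow>
     (\<exists>a b. {a, b} \<in> edges F \<and> z = Inl a \<and> w = Inl b) \<or>
     (\<exists>e\<in>E. \<exists>x y. {x, y} \<in> edges H \<and> z = pst e x \<and> w = pst e y)" (is "?l \<longleftrightarrow> ?r")
proof
  have pair: "\<exists>x y. {x, y} = f \<and> z = q x \<and> w = q y" if "card f = 2" "{z, w} = q ` f"
    for f :: "'d set" and q :: "'d \<Rightarrow> 'a + 'a set \<times> 'b"
  proof -
    obtain x y where "f = {x, y}"
      using \<open>card f = 2\<close> by (auto simp: card_2_iff)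
    with that show ?thesis
      by (auto simp: doubleton_eq_iff)
  qed
  assume ?l
  then consider (old) f' where "f' \<in> edges F" "{z, w} = Inl ` f'"
    | (new) e f' where "e \<in> E" "f' \<in> edges H" "{z, w} = pst e ` f'"
    by (auto simp: pocket_graph_def)
  then show ?r
  proof cases
    case old
    then show ?thesis
      using simple_F pair [of f' Inl] by (fastforce simp: simple_graph_def)
  next
    case new
    then show ?thesis
      using simple_H pair [of f' "pst e"] by (fastforce simp: simple_graph_def)
  qed
next
  assume ?r
  then consider (old) a b where "{a, b} \<in> edges F" "{z, w} = Inl ` {a, b}"
    | (new) e x y where "e \<in> E" "{x, y} \<in> edges H" "{z, w} = pst e ` {x, y}"
    by auto
  then show ?l
    by cases (unfold pocket_graph_def, simp_all only: sgraph.select_convs, blast+)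
qed

text \<open>A copy of \<open>H\<close> meets the old vertices only in the images of \<open>u\<close>
  and \<open>v\<close>, and the edge between them lands on \<open>e\<close>, already an edge of
  \<open>F\<close>.\<close>

lemma edge_G_Inl_Inl: "{Inl a, Inl b} \<in> edges G \<longleftrightarrow> {a, b} \<in> edges F"
proof -
  have "{a, b} \<in> edges F"
    if "e \<in> E" "{x, y} \<in> edges H" "Inl a = pst e x" "Inl b = pst e y" for e x y
  proof -
    have "x \<noteq> y"
      using edge_endpoints_distinct [OF simple_H that(2)] .
    with that(3,4) have "{a, b} = {fst (p e), snd (p e)}"
      by (auto simp: paste_def split: if_splits)
    with orient_edge [OF that(1)] that(1) E_edges show ?thesis
      by auto
  qed
  then show ?thesis
    unfolding edge_G_iff by blast
qed

text \<open>Both \<open>u\<close> and \<open>v\<close> see the whole interior, so the adjacency is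
  the same for either orientation of \<open>e\<close>.\<close>

lemma edge_G_Inl_Inr:
  assumes "y \<in> interior"
  shows "{Inl a, Inr (e, y)} \<in> edges G \<longleftrightarrow> e \<in> E \<and> a \<in> e"
proof
  assume "{Inl a, Inr (e, y)} \<in> edges G"
  then obtain e' x y' where "e' \<in> E" "Inl a = pst e' x" "Inr (e, y) = pst e' y'"
    unfolding edge_G_iff by blast
  then show "e \<in> E \<and> a \<in> e"
    using orient_edge [of e'] by (auto simp: paste_def split: if_splits)
next
  assume e: "e \<in> E \<and> a \<in> e"
  then consider "a = fst (p e)" | "a = snd (p e)"
    using orient_edge [of e] by auto
  then obtain x where "{x, y} \<in> edges H" "Inl a = pst e x"
    using assms u_v_neighbours [of y] paste_simps(1,2) [of e] by (cases) (auto simp: interior_def)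
  then show "{Inl a, Inr (e, y)} \<in> edges G"
    unfolding edge_G_iff using e paste_simps(3) [OF assms, of e] by metis
qed

lemma edge_G_Inr_Inr:
  assumes "e \<in> E" "y \<in> interior" "y' \<in> interior"
  shows "{Inr (e, y), Inr (e', y')} \<in> edges G \<longleftrightarrow> e = e' \<and> {y, y'} \<in> edges H"
proof
  assume "{Inr (e, y), Inr (e', y')} \<in> edges G"
  then show "e = e' \<and> {y, y'} \<in> edges H"
    unfolding edge_G_iff by (auto simp: paste_def split: if_splits)
next
  assume "e = e' \<and> {y, y'} \<in> edges H"
  then show "{Inr (e, y), Inr (e', y')} \<in> edges G"
    unfolding edge_G_iff
    using assms(1) paste_simps(3) [OF assms(2), of e] paste_simps(3) [OF assms(3), of e] by metis
qed

lemma neighbour_G: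
  assumes "{z, w} \<in> edges G"
  shows "w \<in> Inl ` verts F \<union> Inr ` (E \<times> interior)"
  using edge_endpoints_verts(2) [OF simple_G assms] by (simp add: verts_G)

text \<open>Each pocket edge at \<open>a\<close> adds exactly the \<open>h\<close> interior vertices
  of its copy; the pasted edge itself is already counted in \<open>F\<close>.\<close>

lemma degree_Inl:
  "real (vertex_degree G (Inl a)) = real (vertex_degree F a) + h * real (card {e \<in> E. a \<in> e})"
proof -
  have "{w. {Inl a, w} \<in> edges G} =
      Inl ` {b. {a, b} \<in> edges F} \<union> Inr ` ({e \<in> E. a \<in> e} \<times> interior)" (is "?N = Inl ` ?A \<union> Inr ` ?B")
  proof (rule Set.set_eqI)
    fix w show "w \<in> ?N \<longleftrightarrow> w \<in> Inl ` ?A \<union> Inr ` ?B"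
      using neighbour_G [of "Inl a" w]
      by (cases w) (auto simp: edge_G_Inl_Inl edge_G_Inl_Inr)
  qed
  moreover have "finite ?A"
    by (rule finite_subset [of _ "verts F"]) (use edge_endpoints_verts(2) [OF simple_F] simple_F in auto)
  moreover have "finite ?B"
    using finite_E by simp
  ultimately have "card ?N = card (Inl ` ?A :: ('a + 'a set \<times> 'b) set) + card (Inr ` ?B :: ('a + 'a set \<times> 'b) set)"
    by (simp only:) (rule card_Un_disjoint; auto)
  also have "\<dots> = card ?A + card ?B"
    by (simp only: card_image inj_Inl inj_Inr)
  finally have "card ?N = card ?A + card ?B" .
  then show ?thesis
    using card_interior(2)
    by (simp add: vertex_degree_eq_card_neighbours [OF simple_G] vertex_degree_eq_card_neighbours [OF simple_F]
        card_cartesian_product)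
qed

lemma degree_Inr:
  assumes "e \<in> E" "y \<in> interior"
  shows "vertex_degree G (Inr (e, y)) = vertex_degree H y"
proof -
  have "{w. {Inr (e, y), w} \<in> edges G} = Inl ` e \<union> (\<lambda>y'. Inr (e, y')) ` {y' \<in> interior. {y, y'} \<in> edges H}"
    (is "?N = ?A \<union> ?f ` ?B")
  proof -
    have "{Inr (e, y), Inl a} \<in> edges G \<longleftrightarrow> a \<in> e" for a
      using edge_G_Inl_Inr [OF assms(2), of a e] assms(1) by (simp add: insert_commute)
    then have "w \<in> ?N \<longleftrightarrow> w \<in> ?A \<union> ?f ` ?B" for w
      using neighbour_G [of "Inr (e, y)" w] assms by (cases w) (auto simp: edge_G_Inr_Inr)
    then show ?thesis
      by (rule Set.set_eqI)
  qed
  moreover have "finite e"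
    using card_edge [OF assms(1)] by (simp add: card_ge_0_finite)
  moreover have "card (?f ` ?B) = card ?B"
    by (rule card_image) (simp add: inj_on_def)
  moreover have "?A \<inter> ?f ` ?B = {}"
    by auto
  ultimately have "card ?N = card e + card ?B"
    by (simp add: card_Un_disjoint card_image)
  then show ?thesis
    using card_edge [OF assms(1)] degree_interior [OF assms(2)] card_interior_neighbours [OF assms(2)]
    by (simp add: vertex_degree_eq_card_neighbours [OF simple_G])
qed

section \<open>Spectrum of the pocket graph\<close>

lemma poly_char_poly_G:
  fixes x :: real
  assumes "x \<noteq> c"
  shows "poly (set_char_poly (verts G) (Q_entry G)) x =
    set_det (verts F) (\<lambda>a a'. (if a = a' then x - vertex_degree F a - h * card {e \<in> E. a \<in> e}
        else if {a, a'} \<in> edges F then - 1 else 0) - h / (x - c) * card {e \<in> E. a \<in> e \<and> a' \<in> e})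
      * poly interior_poly x ^ card E"
proof -
  let ?M = "\<lambda>a b. (if a = b then x else 0) - Q_entry G a b"
  let ?MH = "\<lambda>y y'. (if y = y' then x else 0) - Q_entry H y y'"
  \<comment> \<open>\<open>?W\<close> is constant on each interior, so the interior block multiplies
    it by its row sum x - c, which yields 1 or 0 by incidence and cancels the entry -1 or 0.\<close>
  let ?W = "\<lambda>b a :: 'a + 'a set \<times> 'b. (case (b, a) of (Inr (e, y), Inl a) \<Rightarrow> (if a \<in> e then 1 / (x - c) else 0) | _ \<Rightarrow> 0)"
  let ?B = "Inr ` (E \<times> interior) :: ('a + 'a set \<times> 'b) set"
  have lower: "?M (Inr (e, y)) (Inl a) = (if a \<in> e then - 1 else 0)"
    and upper: "?M (Inl a) (Inr (e, y)) = (if a \<in> e then - 1 else 0)" if "e \<in> E" "y \<in> interior" for a e y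
    using edge_G_Inl_Inr [OF that(2), of a e] that(1)
    by (auto simp: Q_entry_def insert_commute)
  have diag: "?M (Inr (e, y)) (Inr (e', y')) = (if e = e' then ?MH y y' else 0)"
    if "e \<in> E" "y \<in> interior" "y' \<in> interior" for e e' y y'
    using that by (auto simp: Q_entry_def edge_G_Inr_Inr degree_Inr)
  have sum_B: "(\<Sum>b\<in>?B. f b) = (\<Sum>e\<in>E. \<Sum>y\<in>interior. f (Inr (e, y)))" for f :: "'a + 'a set \<times> 'b \<Rightarrow> real"
    by (subst sum.reindex) (auto simp: sum.cartesian_product inj_on_def)
  have "poly (set_char_poly (verts G) (Q_entry G)) x = set_det (Inl ` verts F \<union> ?B) ?M"
    using simple_G by (simp add: poly_set_char_poly verts_G [symmetric])
  also have "\<dots> = set_det (Inl ` verts F) (\<lambda>a a'. ?M a a' + (\<Sum>b\<in>?B. ?M a b * ?W b a')) * set_det ?B ?M"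
  proof (rule set_det_schur)
    fix z w :: "'a + 'a set \<times> 'b" assume "z \<in> Inl ` verts F" "w \<in> ?B"
    then obtain a e y where zw: "z = Inl a" "w = Inr (e, y)" "e \<in> E" "y \<in> interior"
      by auto
    define t where "t = (if a \<in> e then 1 / (x - c) else 0)"
    have "(\<Sum>b'\<in>?B. ?M w b' * ?W b' z) =
        (\<Sum>e'\<in>E. \<Sum>y'\<in>interior. if e' = e then ?MH y y' * t else 0)"
      unfolding sum_B zw(1,2) by (intro sum.cong refl) (use diag zw in \<open>auto simp: t_def\<close>)
    also have "\<dots> = (\<Sum>e'\<in>E. if e' = e then (x - c) * t else 0)"
    proof (rule sum.cong)
      fix e'
      have "(\<Sum>y'\<in>interior. ?MH y y' * t) = (x - c) * t"
        by (simp only: sum_distrib_right [symmetric] interior_char_row_sum [OF zw(4)])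
      then show "(\<Sum>y'\<in>interior. if e' = e then ?MH y y' * t else 0) = (if e' = e then (x - c) * t else 0)"
        by (cases "e' = e") (simp_all only: simp_thms if_True if_False sum.neutral_const)
    qed simp
    also have "\<dots> = (if a \<in> e then 1 else 0)"
      using finite_E zw(3) assms by (simp add: t_def)
    finally show "?M w z + (\<Sum>b'\<in>?B. ?M w b' * ?W b' z) = 0"
      using lower [OF zw(3,4), of a] by (simp add: zw(1,2))
  qed (use simple_F finite_E in auto)
  also have "set_det (Inl ` verts F) (\<lambda>a a'. ?M a a' + (\<Sum>b\<in>?B. ?M a b * ?W b a')) =
      set_det (verts F) (\<lambda>a a'. (if a = a' then x - vertex_degree F a - h * card {e \<in> E. a \<in> e}
        else if {a, a'} \<in> edges F then - 1 else 0) - h / (x - c) * card {e \<in> E. a \<in> e \<and> a' \<in> e})"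
    (is "_ = set_det _ ?R")
  proof (subst set_det_image)
    have "(\<Sum>b\<in>?B. ?M (Inl a) b * ?W b (Inl a')) = - (h / (x - c)) * card {e \<in> E. a \<in> e \<and> a' \<in> e}" for a a'
    proof -
      have "(\<Sum>b\<in>?B. ?M (Inl a) b * ?W b (Inl a')) =
          (\<Sum>e\<in>E. \<Sum>y\<in>interior. if a \<in> e \<and> a' \<in> e then - 1 / (x - c) else 0)"
        unfolding sum_B by (intro sum.cong refl) (use upper in auto)
      \<comment> \<open>The \<open>h\<close> interior vertices of a copy contribute equally.\<close>
      also have "\<dots> = (\<Sum>e\<in>E. if a \<in> e \<and> a' \<in> e then - (h / (x - c)) else 0)"
        by (rule sum.cong) (auto simp: card_interior(2))
      finally show ?thesis
        using finite_E by (simp flip: sum.inter_filter)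
    qed
    then show "set_det (verts F) (\<lambda>a b. ?M (Inl a) (Inl b) + (\<Sum>b'\<in>?B. ?M (Inl a) b' * ?W b' (Inl b))) =
        set_det (verts F) ?R"
      using simple_F by (intro set_det_cong) (auto simp: Q_entry_def degree_Inl edge_G_Inl_Inl)
  qed (use simple_F in auto)
  \<comment> \<open>Interiors of different copies are not adjacent, and each diagonal block is that
    of \<open>H\<close>.\<close>
  also have "set_det ?B ?M = (\<Prod>e\<in>E. set_det ((\<lambda>y. Inr (e, y)) ` interior) ?M)"
  proof -
    have "?B = (\<Union>e\<in>E. (\<lambda>y. Inr (e, y)) ` interior)"
      by auto
    then show ?thesis
      by (simp only:) (rule set_det_UN_diagonal; use finite_E in \<open>auto simp: Q_entry_def edge_G_Inr_Inr\<close>)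
  qed
  also have "\<dots> = (\<Prod>e\<in>E. poly interior_poly x)"
  proof (rule prod.cong)
    fix e assume "e \<in> E"
    have "set_det ((\<lambda>y. Inr (e, y)) ` interior) ?M = set_det interior (\<lambda>y y'. ?M (Inr (e, y)) (Inr (e, y')))"
      by (rule set_det_image) (auto simp: inj_on_def)
    also have "\<dots> = poly interior_poly x"
      unfolding poly_interior_poly by (rule set_det_cong) (use \<open>e \<in> E\<close> in \<open>auto simp: Q_entry_def edge_G_Inr_Inr degree_Inr\<close>)
    finally show "set_det ((\<lambda>y. Inr (e, y)) ` interior) ?M = poly interior_poly x" .
  qed simp
  finally show ?thesis
    by simp
qed

text \<open>\<open>interior_poly\<close> contributes (x - c)^k times \<open>reduced_poly\<close>^k,
  and the power of x - c is exactly what turns the determinant over \<open>F\<close> into the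
  characteristic polynomial of the quotient.\<close>

lemma Q_spectrum_G:
  "Q_spectrum G = repeat_mset (card E) (proots reduced_poly) +
     proots (set_char_poly (Inl ` verts F \<union> Inr ` E) (pocket_quotient F E h c))"
proof -
  let ?q = "set_char_poly (Inl ` verts F \<union> Inr ` E) (pocket_quotient F E h c)"
  have "set_char_poly (verts G) (Q_entry G) = reduced_poly ^ card E * ?q"
  proof (rule poly_eqI_off_point)
    fix x assume "x \<noteq> c"
    then show "poly (set_char_poly (verts G) (Q_entry G)) x = poly (reduced_poly ^ card E * ?q) x"
      unfolding poly_char_poly_G [OF \<open>x \<noteq> c\<close>] poly_mult
        poly_char_poly_pocket_quotient [OF finite_verts [OF simple_F] finite_E \<open>x \<noteq> c\<close>]
      by (simp add: interior_poly_eq power_mult_distrib flip: left_diff_distrib)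
  qed
  moreover have "?q \<noteq> 0"
    using simple_F finite_E by (intro set_char_poly_nonzero) simp
  ultimately show ?thesis
    using reduced_poly_nonzero by (simp add: Q_spectrum_eq [OF simple_G] proots_mult proots_power)
qed

lemma card_verts_G: "card (verts G) = card (verts F) + card E * (m - 2)"
  unfolding verts_G using simple_F finite_E
  by (subst card_Un_disjoint) (auto simp: card_image card_cartesian_product card_interior)

end

theorem theorem4p2:
  fixes F :: "'a sgraph" and E :: "'a set set" and p p' :: "'a set \<Rightarrow> 'a \<times> 'a"
    and H :: "'b sgraph" and u v :: 'b
    and H' :: "'c sgraph" and u' v' :: 'c
    and n m k r r\<^sub>2 :: nat and \<zeta> \<eta> :: real
  assumes "simple_graph F" and "card (verts F) = n" and "n \<ge> 2"
    and "E \<subseteq> edges F" and "card E = k"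
    and "regular (edge_induced_subgraph E) r"
    and "m \<ge> 3" and "r\<^sub>2 \<ge> 2"
    and "edge_pocket H u v m r\<^sub>2" and "orientation E p"
    and "{x::real. (x - 2 * real r\<^sub>2 - 2) * (x - real m) - 2 * (real m - 2) = 0} = {\<zeta>, \<eta>}"
  shows "(\<forall>q \<in># Q_spectrum H - {#real m - 2, \<zeta>, \<eta>#}.
            (k > 0 \<longrightarrow> q \<in># Q_spectrum (pocket_graph F E p H u v)) \<and>
            count (Q_spectrum (pocket_graph F E p H u v)) q
              \<ge> k * count (Q_spectrum H - {#real m - 2, \<zeta>, \<eta>#}) q) \<and>
         size (Q_spectrum (pocket_graph F E p H u v)
                 - repeat_mset k (Q_spectrum H - {#real m - 2, \<zeta>, \<eta>#})) = n + k \<and>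
         (edge_pocket H' u' v' m r\<^sub>2 \<and> orientation E p' \<longrightarrow>
            Q_spectrum (pocket_graph F E p' H' u' v')
                - repeat_mset k (Q_spectrum H' - {#real m - 2, \<zeta>, \<eta>#})
              = Q_spectrum (pocket_graph F E p H u v)
                - repeat_mset k (Q_spectrum H - {#real m - 2, \<zeta>, \<eta>#}))"
proof -
  interpret pocketed_graph H u v m r\<^sub>2 F E p
    by unfold_locales (use assms in auto)
  \<comment> \<open>Outside the locale \<open>h\<close> and \<open>c\<close> are functions of
    \<open>m\<close> and \<open>r\<^sub>2\<close> alone, so \<open>?R\<close> is literally the same
    term for \<open>H\<close> and for \<open>H'\<close>, under either orientation.\<close>
  let ?R = "proots (set_char_poly (Inl ` verts F \<union> Inr ` E)
    (pocket_quotient F E (edge_pocket_graph.h m) (edge_pocket_graph.c r\<^sub>2)))"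
  have H: "Q_spectrum H - {#real m - 2, \<zeta>, \<eta>#} = proots reduced_poly"
    by (rule Q_spectrum_H) (rule assms)
  have G: "Q_spectrum G = repeat_mset k (proots reduced_poly) + ?R"
    using Q_spectrum_G assms(5) by simp
  have "size (proots reduced_poly) = m - 3"
  proof -
    have "Q_spectrum H = proots reduced_poly + {#real m - 2, \<zeta>, \<eta>#}"
      by (rule Q_spectrum_H_eq) (rule assms)
    then show ?thesis
      using size_Q_spectrum [OF simple_H] card_H by simp
  qed
  moreover have "size (repeat_mset k (proots reduced_poly)) + size ?R = n + k * (m - 2)"
    using size_Q_spectrum [OF simple_G] G card_verts_G assms(2,5) by simp
  \<comment> \<open>Each copy has m - 2 interior vertices but only m - 3 roots of
    \<open>reduced_poly\<close>; the deficit of one per copy yields the summand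
    \<open>k\<close>.\<close>
  moreover have "m - 2 = Suc (m - 3)"
    using assms(7) by simp
  ultimately have "size ?R = n + k"
    by (simp add: size_repeat_mset)
  moreover have "Q_spectrum (pocket_graph F E p' H' u' v')
      - repeat_mset k (Q_spectrum H' - {#real m - 2, \<zeta>, \<eta>#}) = ?R"
    if "edge_pocket H' u' v' m r\<^sub>2" "orientation E p'"
  proof -
    interpret H': pocketed_graph H' u' v' m r\<^sub>2 F E p'
      by unfold_locales (use assms that in auto)
    show ?thesis
      using H'.Q_spectrum_G H'.Q_spectrum_H [OF assms(11)] assms(5) by simp
  qed
  moreover have "q \<in># repeat_mset k (proots reduced_poly)" if "k > 0" "q \<in># proots reduced_poly" for q
    using that by (simp add: count_greater_zero_iff [symmetric] del: count_greater_zero_iff)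
  ultimately show ?thesis
    by (auto simp: H G)
qed

end
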